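(* Let $n,m\ge 0$ be integers. The algebra $\langle[-n,m];\Rightarrow,0\rangle$ is an $\mathbf{I}_{2,0}$-chain, and its order $\sqsubseteq$ is $-n\sqsubset -n+1\sqsubset\cdots\sqsubset -1\sqsubset 0\sqsubset 1\sqsubset\cdots\sqsubset m$ (i.e. it coincides with the usual order of integers).
   Context: A zroupoid is an algebra $\langle A,\to,0\rangle$ with binary $\to$ and constant $0$; $x':=x\to 0$. An implication zroupoid satisfies (I) $(x\to y)\to z\approx[(z'\to x)\to(y\to z)']'$ and $0''\approx 0$; $\mathbf{I}_{2,0}$ is the variety of implication zroupoids satisfying $x''\approx x$. Define $x\sqsubseteq y$ iff $(x\to y')'=x$; $x\sqsubset y$ means $x\sqsubseteq y$ and $x\neq y$. An $\mathbf{I}_{2,0}$-chain is a member of $\mathbf{I}_{2,0}$ on which $\sqsubseteq$ is total. Construction: $[-n,m]=\{x\in\mathbb Z:-n\le x\le m\}$; $p(x)=x-1$ if $x>-n$, $p(-n)=-n$; $0^\ast=m$, $x^\ast=x$ for $x<0$, $x^\ast=p((p(x))^\ast)$ for $x>0$; $x\Rightarrow y=\max(x^\ast,y)$ if $x,y\ge0$ and $\min(x,y)$ otherwise; the constant is $0$. *)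

theory Defs
  imports Main
begin

definition neg :: "('a \<Rightarrow> 'a \<Rightarrow> 'a) \<Rightarrow> 'a \<Rightarrow> 'a \<Rightarrow> 'a" where
  "neg imp z x = imp x z"

locale zroupoid =
  fixes A :: "'a set" and imp :: "'a \<Rightarrow> 'a \<Rightarrow> 'a" and z :: 'a
  assumes zero_closed: "z \<in> A"
    and imp_closed: "x \<in> A \<Longrightarrow> y \<in> A \<Longrightarrow> imp x y \<in> A"

locale implication_zroupoid = zroupoid +
  assumes axiom_I: "x \<in> A \<Longrightarrow> y \<in> A \<Longrightarrow> w \<in> A \<Longrightarrow>
      imp (imp x y) w = neg imp z (imp (imp (neg imp z w) x) (neg imp z (imp y w)))"
    and zero_neg_neg: "neg imp z (neg imp z z) = z"

locale I20 = implication_zroupoid +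
  assumes neg_neg: "x \<in> A \<Longrightarrow> neg imp z (neg imp z x) = x"

definition sqle :: "('a \<Rightarrow> 'a \<Rightarrow> 'a) \<Rightarrow> 'a \<Rightarrow> 'a \<Rightarrow> 'a \<Rightarrow> bool" where
  "sqle imp z x y \<longleftrightarrow> neg imp z (imp x (neg imp z y)) = x"

definition sqless :: "('a \<Rightarrow> 'a \<Rightarrow> 'a) \<Rightarrow> 'a \<Rightarrow> 'a \<Rightarrow> 'a \<Rightarrow> bool" where
  "sqless imp z x y \<longleftrightarrow> sqle imp z x y \<and> x \<noteq> y"

locale I20_chain = I20 +
  assumes sqle_total: "x \<in> A \<Longrightarrow> y \<in> A \<Longrightarrow> sqle imp z x y \<or> sqle imp z y x"

text \<open>The construction on the integer interval from \<open>- n\<close> to \<open>m\<close>. The functions below are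
  defined on all integers; only their values on this interval matter.\<close>

definition seg :: "nat \<Rightarrow> nat \<Rightarrow> int set" where
  "seg n m = {- int n..int m}"

definition pred_seg :: "nat \<Rightarrow> int \<Rightarrow> int" where
  "pred_seg n x = (if x > - int n then x - 1 else - int n)"

function star :: "nat \<Rightarrow> nat \<Rightarrow> int \<Rightarrow> int" where
  "star n m x =
     (if x = 0 then int m
      else if x < 0 then x
      else pred_seg n (star n m (pred_seg n x)))"
  by pat_completeness auto
termination
  by (relation "measure (\<lambda>(n, m, x). nat x)") (auto simp: pred_seg_def)

text \<open>The recursion equation is unconditional and would make the simplifier loop.\<close>
declare star.simps [simp del]

definition seg_imp :: "nat \<Rightarrow> nat \<Rightarrow> int \<Rightarrow> int \<Rightarrow> int" where
  "seg_imp n m x y = (if x \<ge> 0 \<and> y \<ge> 0 then max (star n m x) y else min x y)"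

end

theory Submission
  imports Defs
begin

text \<open>On \<open>[0, m]\<close> the involution is \<open>x\<^sup>* = m - x\<close>, so \<open>\<Rightarrow>\<close> is there the implication
  \<open>\<not> x \<or> y\<close> of a Kleene chain, while as soon as a negative element occurs \<open>\<Rightarrow>\<close> is the minimum and
  the derived negation fixes the result. Both regimes satisfy the identities by a finite case
  distinction.\<close>

text \<open>Each unfolding of the recursion lowers the value by one.\<close>

lemma star_nonneg:
  assumes "0 \<le> x" "x \<le> int m"
  shows "star n m x = int m - x"
  using assms
proof (induction x rule: int_ge_induct)
  case base
  show ?case by (simp add: star.simps)
next
  case (step i)
  have "star n m (i + 1) = pred_seg n (star n m i)"
    using step.hyps by (subst star.simps) (simp add: pred_seg_def)
  \<comment> \<open>The truncation at \<open>- n\<close> is not reached: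
    \<open>i + 1 \<le> m\<close> gives \<open>m - i > 0\<close>.\<close>
  then show ?case using step by (simp add: pred_seg_def)
qed

lemma seg_imp_eq:
  assumes "x \<le> int m"
  shows "seg_imp n m x y = (if x \<ge> 0 \<and> y \<ge> 0 then max (int m - x) y else min x y)"
  using assms by (simp add: seg_imp_def star_nonneg)

lemma neg_seg_imp_eq:
  assumes "x \<le> int m"
  shows "neg (seg_imp n m) 0 x = (if x \<ge> 0 then int m - x else x)"
  using assms by (simp add: neg_def seg_imp_eq)

lemma zero_in_seg: "0 \<in> seg n m"
  by (simp add: seg_def)

lemma seg_imp_closed:
  assumes "x \<in> seg n m" "y \<in> seg n m"
  shows "seg_imp n m x y \<in> seg n m"
  using assms by (auto simp: seg_def seg_imp_eq)

lemma neg_seg_imp_neg: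
  assumes "x \<le> int m"
  shows "neg (seg_imp n m) 0 (neg (seg_imp n m) 0 x) = x"
  using assms by (simp add: neg_seg_imp_eq)

text \<open>For nonnegative arguments this is distributivity: both sides are
  \<open>(x \<and> \<not> y) \<or> w\<close>. Otherwise both are the least of \<open>x\<close>,
  \<open>y\<close>, \<open>w\<close>.\<close>

lemma seg_imp_axiom_I:
  fixes n m :: nat
  assumes "x \<le> int m" "y \<le> int m" "w \<le> int m"
  defines "N \<equiv> neg (seg_imp n m) 0"
  shows "seg_imp n m (seg_imp n m x y) w =
    N (seg_imp n m (seg_imp n m (N w) x) (N (seg_imp n m y w)))"
  unfolding N_def using assms(1-3)
  by (cases "0 \<le> x"; cases "0 \<le> y"; cases "0 \<le> w")
    (simp_all add: seg_imp_eq neg_seg_imp_eq max_def min_def)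

text \<open>In every case the term defining \<open>sqle\<close> evaluates to
  \<open>min x y\<close>.\<close>

lemma sqle_seg_imp_iff:
  assumes "x \<le> int m" "y \<le> int m"
  shows "sqle (seg_imp n m) 0 x y \<longleftrightarrow> x \<le> y"
  unfolding sqle_def using assms
  by (cases "0 \<le> x"; cases "0 \<le> y")
    (auto simp: seg_imp_eq neg_seg_imp_eq max_def min_def)

theorem theorem4p9:
  fixes n m :: nat
  shows "I20_chain (seg n m) (seg_imp n m) 0 \<and>
    (\<forall>x\<in>seg n m. \<forall>y\<in>seg n m.
       (sqle (seg_imp n m) 0 x y \<longleftrightarrow> x \<le> y) \<and>
       (sqless (seg_imp n m) 0 x y \<longleftrightarrow> x < y))"
proof
  have le_m: "x \<le> int m" if "x \<in> seg n m" for x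
    using that by (simp add: seg_def)
  show "I20_chain (seg n m) (seg_imp n m) 0"
  proof unfold_locales
    fix x y w
    assume "x \<in> seg n m" "y \<in> seg n m" "w \<in> seg n m"
    then show "seg_imp n m (seg_imp n m x y) w =
        neg (seg_imp n m) 0 (seg_imp n m (seg_imp n m (neg (seg_imp n m) 0 w) x)
          (neg (seg_imp n m) 0 (seg_imp n m y w)))"
      by (intro seg_imp_axiom_I le_m)
  \<comment> \<open>Totality is inherited from the linear order of the integers.\<close>
  qed (auto simp: zero_in_seg seg_imp_closed neg_seg_imp_neg sqle_seg_imp_iff le_m)
  show "\<forall>x\<in>seg n m. \<forall>y\<in>seg n m.
       (sqle (seg_imp n m) 0 x y \<longleftrightarrow> x \<le> y) \<and>
       (sqless (seg_imp n m) 0 x y \<longleftrightarrow> x < y)"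
    by (auto simp: sqless_def sqle_seg_imp_iff le_m)
qed

end
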